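(* Let $A$ be a subalgebra of $C(\Omega,\mathbb{C})$ satisfying the bounded condition with respect to $V$ and let $W$ be a topological vector subspace of $C(\Omega,X)$. Let $S$ be a closed subset of $\Omega$. Take a linear subspace $G$ of $CV_0W$ which is an $A$-module (i.e. $AG\subset G$) and such that $g|_S=0$ for all $g\in G$. Assume the following conditions hold: (i) $A$ is self-adjoint (i.e. $f\in A\Rightarrow\overline{f}\in A$); (ii) $A$ separates $\Omega\setminus S$, i.e. for all $x\ne y$ in $\Omega\setminus S$ there is $\varphi\in A$ with $\varphi(x)\ne\varphi(y)$; (iii) every $\varphi\in A$ vanishes on $S$, and for every $t\in\Omega\setminus S$ there is $\varphi\in A$ with $\varphi(t)\neq0$; (iv) for every $\varepsilon>0$, $p\in\mathcal{A}$, and for every $t\in\Omega\setminus S$, $y\in X$, there exists $f\in G$ such that $p(f(t)-y)<\varepsilon$. Then $\overline{G}=\{f\in CV_0W: f|_S=0\}$ in $CV_0W$, and $\overline{A}=\{\varphi\in C(\Omega,\mathbb{C}):\varphi|_S=0\}$ in the compact-open topology.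
   Context: $\Omega$ is a topological space (not assumed Hausdorff). $X$ is a locally convex topological vector space (not assumed Hausdorff) with a family of seminorms $\mathcal{A}$. $C(\Omega,X)$ is the space of continuous maps $\Omega\to X$. For a map $f$ on $\Omega$, $\operatorname{supp} f$ is the closure of $\{x:f(x)\ne0\}$. $V$ is a Nachbin family, i.e. a set of upper semicontinuous functions $\Omega\to\mathbb{R}_+=[0,\infty)$, called weights. For $W\subset C(\Omega,X)$, the weighted space $CV_0W$ is the set of $f\in W$ such that for all $v\in V$, $p\in\mathcal{A}$, $\epsilon>0$ the set $\{x\in\Omega:v(x)p(f(x))\ge\epsilon\}$ is compact. Put $|f|_{v,p}=\sup_{x\in\Omega}v(x)p(f(x))$. The topology of $CV_0W$ is the one with local base at $0$ given by the sets $\{f\in CV_0W:|f|_{v,p}<\epsilon\}$, $v\in V$, $p\in\mathcal{A}$, $\epsilon>0$. Bounded condition: a subset $A\subset C(\Omega,\mathbb{C})$ satisfies the bounded condition with respect to $V$ if every $\varphi\in A$ is bounded on $\operatorname{supp} v$ for every $v\in V$. Subalgebras are not assumed to contain the constants. The compact-open topology is the topology of uniform convergence on compact subsets of $\Omega$.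
   Formalization: The equality for the closure of G is proved assuming that any f in CV_0W with v(x)p(f(x)) = 0 for all x in S, v in V and all seminorms p vanishes on S (it fails e.g. for V = {0}); that the closure contains every f in CV_0W with f|_S = 0 is proved without this. *)

theory Defs
  imports "HOL-Analysis.Analysis" "HOL-Library.Function_Algebras"
begin

text \<open>
  \<open>\<Omega>\<close> is a type of class \<^class>\<open>topological_space\<close>, with no separation axiom.
  \<open>X\<close> is a type carrying a complex vector space structure \<open>smult_X\<close> (locale
  \<^locale>\<open>vector_space\<close>); its topology is not a type class instance but the explicit
  \<open>seminorm_topology \<P>\<close>, which need not be Hausdorff. Sums, differences and \<open>0\<close> of functions are
  pointwise (theory \<open>Function_Algebras\<close>).
\<close>

definition seminorm :: "(complex \<Rightarrow> 'x::ab_group_add \<Rightarrow> 'x) \<Rightarrow> ('x \<Rightarrow> real) \<Rightarrow> bool" where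
  "seminorm smult_X p \<longleftrightarrow>
     (\<forall>x. 0 \<le> p x) \<and> (\<forall>x y. p (x + y) \<le> p x + p y) \<and> (\<forall>c x. p (smult_X c x) = cmod c * p x)"

text \<open>The family need not be directed: finite intersections come from
  \<^const>\<open>topology_generated_by\<close>. The set \<^term>\<open>UNIV\<close> matters only for an empty family.\<close>

definition seminorm_topology :: "('x::ab_group_add \<Rightarrow> real) set \<Rightarrow> 'x topology" where
  "seminorm_topology \<P> =
     topology_generated_by (insert UNIV {{y. p (y - x) < e} | p x e. p \<in> \<P> \<and> 0 < e})"

definition continuous_maps ::
    "('x::ab_group_add \<Rightarrow> real) set \<Rightarrow> ('a::topological_space \<Rightarrow> 'x) set" where
  "continuous_maps \<P> = {f. continuous_map euclidean (seminorm_topology \<P>) f}"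

definition function_subspace ::
    "(complex \<Rightarrow> 'x::ab_group_add \<Rightarrow> 'x) \<Rightarrow> ('a \<Rightarrow> 'x) set \<Rightarrow> bool" where
  "function_subspace smult_X W \<longleftrightarrow> module.subspace (\<lambda>c f t. smult_X c (f t)) W"

definition supp :: "('a::topological_space \<Rightarrow> 'b::zero) \<Rightarrow> 'a set" where
  "supp f = closure {x. f x \<noteq> 0}"

definition upper_semicontinuous :: "('a::topological_space \<Rightarrow> real) \<Rightarrow> bool" where
  "upper_semicontinuous v \<longleftrightarrow> (\<forall>a. open {x. v x < a})"

definition nachbin_family :: "('a::topological_space \<Rightarrow> real) set \<Rightarrow> bool" where
  "nachbin_family V \<longleftrightarrow> (\<forall>v\<in>V. upper_semicontinuous v \<and> (\<forall>x. 0 \<le> v x))"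

definition CV0 ::
    "('x::ab_group_add \<Rightarrow> real) set \<Rightarrow> ('a::topological_space \<Rightarrow> real) set \<Rightarrow> ('a \<Rightarrow> 'x) set
     \<Rightarrow> ('a \<Rightarrow> 'x) set" where
  "CV0 \<P> V W = {f \<in> W. \<forall>v\<in>V. \<forall>p\<in>\<P>. \<forall>e>0. compact {x. e \<le> v x * p (f x)}}"

text \<open>The supremum is a genuine real supremum on \<^const>\<open>CV0\<close>: there \<open>v \<cdot> p \<circ> f\<close> is upper
  semicontinuous and smaller than \<open>1\<close> off a compact set, hence bounded.\<close>

definition weighted_seminorm :: "('a \<Rightarrow> real) \<Rightarrow> ('x \<Rightarrow> real) \<Rightarrow> ('a \<Rightarrow> 'x) \<Rightarrow> real" where
  "weighted_seminorm v p f = (SUP x. v x * p (f x))"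

text \<open>The translation-invariant topology on \<^const>\<open>CV0\<close> generated by the sets
  \<open>{f. |f|\<^sub>v\<^sub>,\<^sub>p < e}\<close>. These sets form a local base at \<open>0\<close>, rather than just a subbase, only if they
  are suitably directed; that property is \<open>CV0_local_base\<close> below. It holds, for instance,
  if \<open>V\<close> and \<open>\<P>\<close> are nonempty and directed up to positive factors. The set \<^term>\<open>CV0 \<P> V W\<close> is
  inserted so that it is the whole space even if \<open>V\<close> or \<open>\<P>\<close> is empty.\<close>

definition CV0_topology ::
    "('x::ab_group_add \<Rightarrow> real) set \<Rightarrow> ('a::topological_space \<Rightarrow> real) set \<Rightarrow> ('a \<Rightarrow> 'x) set
     \<Rightarrow> ('a \<Rightarrow> 'x) topology" where
  "CV0_topology \<P> V W = topology_generated_by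
     (insert (CV0 \<P> V W)
       {{g \<in> CV0 \<P> V W. weighted_seminorm v p (g - f) < e} | f v p e.
          f \<in> CV0 \<P> V W \<and> v \<in> V \<and> p \<in> \<P> \<and> 0 < e})"

definition CV0_local_base ::
    "('x::ab_group_add \<Rightarrow> real) set \<Rightarrow> ('a::topological_space \<Rightarrow> real) set \<Rightarrow> ('a \<Rightarrow> 'x) set
     \<Rightarrow> bool" where
  "CV0_local_base \<P> V W \<longleftrightarrow>
     neighbourhood_base_at 0
       (\<lambda>N. \<exists>v\<in>V. \<exists>p\<in>\<P>. \<exists>e>0. N = {f \<in> CV0 \<P> V W. weighted_seminorm v p f < e})
       (CV0_topology \<P> V W)"

definition complex_continuous_maps :: "('a::topological_space \<Rightarrow> complex) set" where
  "complex_continuous_maps = {f. continuous_on UNIV f}"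

text \<open>Uniform convergence on compact sets. Requiring the strict inequality pointwise on \<open>K\<close> is the
  same as requiring it for the supremum over \<open>K\<close>, since \<open>|\<psi> - \<phi>|\<close> attains its maximum on \<open>K\<close>.\<close>

definition compact_open_topology :: "('a::topological_space \<Rightarrow> complex) topology" where
  "compact_open_topology = topology_generated_by
     {{\<psi> \<in> complex_continuous_maps. \<forall>x\<in>K. cmod (\<psi> x - \<phi> x) < e} | \<phi> K e.
        \<phi> \<in> complex_continuous_maps \<and> compact K \<and> 0 < e}"

text \<open>The constants need not belong to a subalgebra.\<close>

definition function_subalgebra :: "('a::topological_space \<Rightarrow> complex) set \<Rightarrow> bool" where
  "function_subalgebra A \<longleftrightarrow>
     A \<subseteq> complex_continuous_maps \<and> function_subspace (*) A \<and> (\<forall>f\<in>A. \<forall>g\<in>A. f * g \<in> A)"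

definition bounded_condition ::
    "('a::topological_space \<Rightarrow> complex) set \<Rightarrow> ('a \<Rightarrow> real) set \<Rightarrow> bool" where
  "bounded_condition A V \<longleftrightarrow> (\<forall>\<phi>\<in>A. \<forall>v\<in>V. bounded (\<phi> ` supp v))"

text \<open>The weighted seminorms see whether an element of \<^const>\<open>CV0\<close> vanishes on \<open>S\<close>. This holds
  if, for instance, \<open>X\<close> is Hausdorff and every point of \<open>S\<close> has a weight that is positive there.
  It fails if, say, \<open>S\<close> is nonempty, \<open>V = {0}\<close> and \<open>W\<close> consists of all continuous maps to \<open>\<complex>\<close>:
  the topology of \<^const>\<open>CV0\<close> is then indiscrete, and \<open>{f. f|\<^sub>S = 0}\<close> is not closed.\<close>

definition weights_detect_zero_on ::
    "('x::ab_group_add \<Rightarrow> real) set \<Rightarrow> ('a::topological_space \<Rightarrow> real) set \<Rightarrow> ('a \<Rightarrow> 'x) set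
     \<Rightarrow> 'a set \<Rightarrow> bool" where
  "weights_detect_zero_on \<P> V W S \<longleftrightarrow>
     (\<forall>f \<in> CV0 \<P> V W. (\<forall>x\<in>S. \<forall>v\<in>V. \<forall>p\<in>\<P>. v x * p (f x) = 0) \<longrightarrow> (\<forall>x\<in>S. f x = 0))"

end

theory Submission
  imports Defs
begin

text \<open>
  Fix a weight \<open>v\<close>, a seminorm \<open>p\<close> and \<open>e > 0\<close>. For \<open>f\<close> in the weighted space vanishing on \<open>S\<close>, the set
  \<open>K = {v \<cdot> p \<circ> f \<ge> e}\<close> is compact and misses \<open>S\<close>. At each \<open>t \<in> K\<close> some \<open>g\<^sub>t \<in> G\<close> is close to \<open>f\<close>, and
  \<open>{v \<cdot> p \<circ> (g\<^sub>t - f) \<ge> e}\<close> is a compact set not containing \<open>t\<close>. Uniform limits of \<open>A\<close> on \<open>supp v\<close>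
  contain a bump function that is \<open>1\<close> near \<open>t\<close> and \<open>0\<close> on that set. Finitely many of the \<open>g\<^sub>t\<close> are glued with
  these bump functions; off \<open>K\<close> nothing has to be done, because \<open>f\<close> is already small there.
  The statement about \<open>A\<close> is the same argument with \<open>G = A\<close>, \<open>p = |\<cdot>|\<close> and \<open>v\<close> the indicator function
  of a compact set.
\<close>

section \<open>Seminorms and spaces of vector-valued functions\<close>

lemma seminorm_zero:
  assumes "vector_space smult_X" "seminorm smult_X p"
  shows "p 0 = 0"
proof -
  interpret vector_space smult_X by fact
  have "p (smult_X 0 0) = cmod 0 * p 0"
    using assms(2) unfolding seminorm_def by blast
  then show ?thesis by simp
qed

lemma seminorm_minus:
  assumes "vector_space smult_X" "seminorm smult_X p"
  shows "p (- x) = p x"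
proof -
  interpret vector_space smult_X by fact
  have "p (smult_X (- 1) x) = cmod (- 1) * p x"
    using assms(2) unfolding seminorm_def by blast
  then show ?thesis by simp
qed

lemma seminorm_add: "seminorm smult_X p \<Longrightarrow> p (x + y) \<le> p x + p y"
  and seminorm_scale: "seminorm smult_X p \<Longrightarrow> p (smult_X c x) = cmod c * p x"
  and seminorm_nonneg: "seminorm smult_X p \<Longrightarrow> 0 \<le> p x"
  unfolding seminorm_def by blast+

lemma seminorm_diff:
  assumes "vector_space smult_X" "seminorm smult_X p"
  shows "p (x - y) \<le> p x + p y"
  using seminorm_add[OF assms(2), of x "- y"] seminorm_minus[OF assms] by simp

text \<open>\<open>module.subspace\<close> unfolds only once pointwise scaling is known to form a
  module; the module axioms are inherited pointwise from \<open>smult_X\<close>.\<close>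

lemma function_subspace_iff:
  fixes smult_X :: "complex \<Rightarrow> 'x::ab_group_add \<Rightarrow> 'x" and W :: "('a \<Rightarrow> 'x) set"
  assumes "vector_space smult_X"
  shows "function_subspace smult_X W \<longleftrightarrow>
    0 \<in> W \<and> (\<forall>f\<in>W. \<forall>g\<in>W. f + g \<in> W) \<and> (\<forall>c. \<forall>f\<in>W. (\<lambda>t. smult_X c (f t)) \<in> W)"
proof -
  interpret vector_space smult_X by fact
  have "module (\<lambda>c (f :: 'a \<Rightarrow> 'x) t. smult_X c (f t))"
    by unfold_locales (auto simp: fun_eq_iff algebra_simps scale_left_distrib scale_right_distrib)
  from module.subspace_def[OF this] show ?thesis
    unfolding function_subspace_def by auto
qed

lemma function_subspace_diff:
  assumes "vector_space smult_X" "function_subspace smult_X W" "f \<in> W" "g \<in> W"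
  shows "f - g \<in> W"
proof -
  interpret vector_space smult_X by fact
  have "(\<lambda>t. smult_X (- 1) (g t)) \<in> W"
    using assms unfolding function_subspace_iff[OF assms(1)] by blast
  moreover have "(\<lambda>t. smult_X (- 1) (g t)) = - g" by (auto simp: fun_eq_iff)
  ultimately have "f + - g \<in> W"
    using assms by (metis function_subspace_iff[OF assms(1)])
  then show ?thesis by simp
qed

section \<open>Self-adjoint separating algebras, their uniform limits and bump functions\<close>

text \<open>\<open>T\<close> is where \<open>A\<close> is bounded and where uniform approximation
  takes place: \<open>supp v\<close> for a weight \<open>v\<close>, or a compact set for the
  compact-open topology.\<close>

locale separating_algebra =
  fixes A :: "('a::topological_space \<Rightarrow> complex) set" and S T :: "'a set"
  assumes zero_mem: "(\<lambda>x. 0) \<in> A"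
    and add_mem: "\<And>f g. f \<in> A \<Longrightarrow> g \<in> A \<Longrightarrow> (\<lambda>x. f x + g x) \<in> A"
    and scale_mem: "\<And>c f. f \<in> A \<Longrightarrow> (\<lambda>x. c * f x) \<in> A"
    and mult_mem: "\<And>f g. f \<in> A \<Longrightarrow> g \<in> A \<Longrightarrow> (\<lambda>x. f x * g x) \<in> A"
    and cnj_mem: "\<And>f. f \<in> A \<Longrightarrow> (\<lambda>x. cnj (f x)) \<in> A"
    and continuous: "\<And>f. f \<in> A \<Longrightarrow> continuous_on UNIV f"
    and bounded_image: "\<And>f. f \<in> A \<Longrightarrow> bounded (f ` T)"
    and separates: "\<And>x y. x \<notin> S \<Longrightarrow> y \<notin> S \<Longrightarrow> x \<noteq> y \<Longrightarrow> \<exists>f\<in>A. f x \<noteq> f y"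
    and vanishes: "\<And>f x. f \<in> A \<Longrightarrow> x \<in> S \<Longrightarrow> f x = 0"
    and nonvanishing: "\<And>x. x \<notin> S \<Longrightarrow> \<exists>f\<in>A. f x \<noteq> 0"
begin

text \<open>The limits are real-valued, so that cutoffs and convex combinations make sense, although
  \<open>A\<close> is complex. Only the values on \<open>T\<close> are constrained.\<close>

definition uniform_limits :: "('a \<Rightarrow> real) set" where
  "uniform_limits = {h. \<forall>e>0. \<exists>f\<in>A. \<forall>x\<in>T. cmod (f x - of_real (h x)) \<le> e}"

lemma uniform_limitsE:
  assumes "h \<in> uniform_limits" "0 < e"
  obtains f where "f \<in> A" "\<And>x. x \<in> T \<Longrightarrow> cmod (f x - of_real (h x)) \<le> e"
  using assms unfolding uniform_limits_def by blast

lemma bounded_mem: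
  assumes "f \<in> A"
  obtains M where "0 < M" "\<And>x. x \<in> T \<Longrightarrow> cmod (f x) \<le> M"
  using bounded_image[OF assms] unfolding bounded_pos by auto

lemma uniform_limits_bounded:
  assumes "h \<in> uniform_limits"
  obtains M where "0 < M" "\<And>x. x \<in> T \<Longrightarrow> \<bar>h x\<bar> \<le> M"
proof -
  obtain f where f: "f \<in> A" "\<And>x. x \<in> T \<Longrightarrow> cmod (f x - of_real (h x)) \<le> 1"
    using uniform_limitsE[OF assms, of 1] by auto
  obtain M where M: "0 < M" "\<And>x. x \<in> T \<Longrightarrow> cmod (f x) \<le> M"
    using bounded_mem[OF f(1)] by blast
  have "\<bar>h x\<bar> \<le> M + 1" if "x \<in> T" for x
    using f(2)[OF that] M(2)[OF that] norm_triangle_sub[of "of_real (h x)" "f x"]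
    by (simp add: norm_minus_commute)
  then show thesis using that[of "M + 1"] M(1) by auto
qed

lemma uniform_limits_zero: "(\<lambda>x. 0) \<in> uniform_limits"
  unfolding uniform_limits_def by (auto intro!: bexI[of _ "\<lambda>x. 0"] zero_mem)

lemma uniform_limits_add:
  assumes "h \<in> uniform_limits" "k \<in> uniform_limits"
  shows "(\<lambda>x. h x + k x) \<in> uniform_limits"
  unfolding uniform_limits_def
proof clarify
  fix e :: real assume e: "0 < e"
  obtain f where f: "f \<in> A" "\<And>x. x \<in> T \<Longrightarrow> cmod (f x - of_real (h x)) \<le> e / 2"
    using uniform_limitsE[OF assms(1), of "e / 2"] e by auto
  obtain g where g: "g \<in> A" "\<And>x. x \<in> T \<Longrightarrow> cmod (g x - of_real (k x)) \<le> e / 2"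
    using uniform_limitsE[OF assms(2), of "e / 2"] e by auto
  have "cmod (f x + g x - of_real (h x + k x)) \<le> e" if "x \<in> T" for x
    using f(2)[OF that] g(2)[OF that]
      norm_diff_triangle_ineq[of "f x" "g x" "of_real (h x)" "of_real (k x)"] by simp
  then show "\<exists>f\<in>A. \<forall>x\<in>T. cmod (f x - of_real (h x + k x)) \<le> e"
    by (intro bexI[OF _ add_mem[OF f(1) g(1)]]) auto
qed

lemma uniform_limits_mult:
  assumes "h \<in> uniform_limits" "k \<in> uniform_limits"
  shows "(\<lambda>x. h x * k x) \<in> uniform_limits"
  unfolding uniform_limits_def
proof clarify
  fix e :: real assume e: "0 < e"
  obtain M where M: "0 < M" "\<And>x. x \<in> T \<Longrightarrow> \<bar>k x\<bar> \<le> M"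
    using uniform_limits_bounded[OF assms(2)] by blast
  obtain f where f: "f \<in> A" "\<And>x. x \<in> T \<Longrightarrow> cmod (f x - of_real (h x)) \<le> e / (2 * M)"
    using uniform_limitsE[OF assms(1), of "e / (2 * M)"] e M by auto
  \<comment> \<open>The bound \<open>N\<close> belongs to the chosen \<open>f\<close>, so the
    accuracy demanded of \<open>g\<close> is fixed only afterwards.\<close>
  obtain N where N: "0 < N" "\<And>x. x \<in> T \<Longrightarrow> cmod (f x) \<le> N"
    using bounded_mem[OF f(1)] by blast
  obtain g where g: "g \<in> A" "\<And>x. x \<in> T \<Longrightarrow> cmod (g x - of_real (k x)) \<le> e / (2 * N)"
    using uniform_limitsE[OF assms(2), of "e / (2 * N)"] e N by auto
  have "cmod (f x * g x - of_real (h x * k x)) \<le> e" if "x \<in> T" for x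
  proof -
    have "f x * g x - of_real (h x * k x)
        = f x * (g x - of_real (k x)) + (f x - of_real (h x)) * of_real (k x)"
      by (simp add: algebra_simps)
    then have "cmod (f x * g x - of_real (h x * k x))
        \<le> cmod (f x) * cmod (g x - of_real (k x)) + cmod (f x - of_real (h x)) * \<bar>k x\<bar>"
      using norm_triangle_ineq[of "f x * (g x - of_real (k x))" "(f x - of_real (h x)) * of_real (k x)"]
      by (simp add: norm_mult)
    also have "\<dots> \<le> N * (e / (2 * N)) + e / (2 * M) * M"
      using f(2)[OF that] g(2)[OF that] M(2)[OF that] N(2)[OF that] M(1) N(1) e
      by (intro add_mono mult_mono) auto
    also have "\<dots> = e" using M(1) N(1) by (simp add: field_simps)
    finally show ?thesis .
  qed
  then show "\<exists>f\<in>A. \<forall>x\<in>T. cmod (f x - of_real (h x * k x)) \<le> e"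
    by (intro bexI[OF _ mult_mem[OF f(1) g(1)]]) auto
qed

lemma mem_uniform_limits: "(\<lambda>x. of_real (h x)) \<in> A \<Longrightarrow> h \<in> uniform_limits"
  unfolding uniform_limits_def by (auto intro!: bexI[of _ "\<lambda>x. of_real (h x)"])

lemma uniform_limits_scale:
  assumes "h \<in> uniform_limits"
  shows "(\<lambda>x. c * h x) \<in> uniform_limits"
  unfolding uniform_limits_def
proof clarify
  fix e :: real assume e: "0 < e"
  obtain f where f: "f \<in> A" "\<And>x. x \<in> T \<Longrightarrow> cmod (f x - of_real (h x)) \<le> e / (\<bar>c\<bar> + 1)"
    using uniform_limitsE[OF assms, of "e / (\<bar>c\<bar> + 1)"] e by auto
  have "cmod (of_real c * f x - of_real (c * h x)) \<le> e" if "x \<in> T" for x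
  proof -
    have "cmod (of_real c * f x - of_real (c * h x)) = \<bar>c\<bar> * cmod (f x - of_real (h x))"
      by (simp add: right_diff_distrib[symmetric] norm_mult)
    also have "\<dots> \<le> (\<bar>c\<bar> + 1) * (e / (\<bar>c\<bar> + 1))"
      using f(2)[OF that] by (intro mult_mono) auto
    finally show ?thesis by simp
  qed
  then show "\<exists>f\<in>A. \<forall>x\<in>T. cmod (f x - of_real (c * h x)) \<le> e"
    by (intro bexI[OF _ scale_mem[OF f(1), of "of_real c"]]) auto
qed

lemma uniform_limits_diff:
  assumes "h \<in> uniform_limits" "k \<in> uniform_limits"
  shows "(\<lambda>x. h x - k x) \<in> uniform_limits"
  using uniform_limits_add[OF assms(1) uniform_limits_scale[OF assms(2), of "- 1"]] by simp

lemma uniform_limits_power_sum: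
  assumes "u \<in> uniform_limits"
  shows "(\<lambda>x. \<Sum>i=1..n. a i * u x ^ i) \<in> uniform_limits"
proof -
  \<comment> \<open>The induction starts at the first power: the zeroth is the constant 1, which
    need not be a uniform limit of \<open>A\<close>.\<close>
  have pow: "(\<lambda>x. u x ^ Suc i) \<in> uniform_limits" for i
  proof (induction i)
    case 0
    then show ?case using assms by simp
  next
    case (Suc i)
    show ?case using uniform_limits_mult[OF assms Suc] by simp
  qed
  show ?thesis
  proof (induction n)
    case 0
    then show ?case by (simp add: uniform_limits_zero)
  next
    case (Suc n)
    show ?case
      using uniform_limits_add[OF Suc uniform_limits_scale[OF pow]] by simp
  qed
qed

lemma uniform_limits_closed:
  assumes "\<And>e. 0 < e \<Longrightarrow> \<exists>k\<in>uniform_limits. \<forall>x\<in>T. \<bar>k x - h x\<bar> \<le> e"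
  shows "h \<in> uniform_limits"
  unfolding uniform_limits_def
proof clarify
  fix e :: real assume e: "0 < e"
  obtain k where k: "k \<in> uniform_limits" "\<And>x. x \<in> T \<Longrightarrow> \<bar>k x - h x\<bar> \<le> e / 2"
    using assms[of "e / 2"] e by auto
  obtain f where f: "f \<in> A" "\<And>x. x \<in> T \<Longrightarrow> cmod (f x - of_real (k x)) \<le> e / 2"
    using uniform_limitsE[OF k(1), of "e / 2"] e by auto
  have "cmod (f x - of_real (h x)) \<le> e" if "x \<in> T" for x
  proof -
    have "cmod (of_real (k x) - of_real (h x)) \<le> e / 2"
      using k(2)[OF that] by (metis norm_of_real of_real_diff)
    then show ?thesis using f(2)[OF that] norm_triangle_le[of "f x - of_real (k x)" "of_real (k x) - of_real (h x)" e]
      by simp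
  qed
  then show "\<exists>f\<in>A. \<forall>x\<in>T. cmod (f x - of_real (h x)) \<le> e" using f(1) by blast
qed

text \<open>\<open>A\<close> may lack constants, so only polynomials without constant term may be applied; the condition
  \<open>F 0 = 0\<close> makes them suffice.\<close>

lemma uniform_limits_compose:
  fixes F :: "real \<Rightarrow> real"
  assumes u: "u \<in> uniform_limits" and F: "continuous_on UNIV F" "F 0 = 0"
  shows "(\<lambda>x. F (u x)) \<in> uniform_limits"
proof (rule uniform_limits_closed)
  fix e :: real assume e: "0 < e"
  obtain M where M: "0 < M" "\<And>x. x \<in> T \<Longrightarrow> \<bar>u x\<bar> \<le> M"
    using uniform_limits_bounded[OF u] by blast
  obtain g where g: "polynomial_function g" "\<And>y. y \<in> {-M..M} \<Longrightarrow> norm (F y - g y) < e / 2"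
    using Stone_Weierstrass_polynomial_function[of "{-M..M}" F "e / 2"] e
      continuous_on_subset[OF F(1)] by auto
  obtain a n where an: "g = (\<lambda>y. \<Sum>i\<le>n. a i * y ^ i)"
    using g(1) by (auto simp: real_polynomial_function_eq[symmetric] real_polynomial_function_iff_sum)
  \<comment> \<open>\<open>?k\<close> is \<open>g\<close> without its constant term
    \<open>g 0\<close>. Since 0 lies in the approximation interval, \<open>g 0\<close> is within
    \<open>e / 2\<close> of \<open>F 0 = 0\<close>, so dropping it costs at most another
    \<open>e / 2\<close>.\<close>
  let ?k = "\<lambda>y. \<Sum>i=1..n. a i * y ^ i"
  have k: "?k y = g y - g 0" for y
  proof -
    have "{..n} = insert 0 {1..n}" by auto
    then show ?thesis unfolding an by (simp add: sum.atLeast_Suc_atMost power_0_left)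
  qed
  have "\<bar>?k (u x) - F (u x)\<bar> \<le> e" if "x \<in> T" for x
  proof -
    have "\<bar>F (u x) - g (u x)\<bar> < e / 2" "\<bar>F 0 - g 0\<bar> < e / 2"
      using g(2)[of "u x"] g(2)[of 0] M(1) M(2)[OF that] by (auto simp: abs_le_iff)
    then show ?thesis using F(2) unfolding k by linarith
  qed
  then show "\<exists>k\<in>uniform_limits. \<forall>x\<in>T. \<bar>k x - F (u x)\<bar> \<le> e"
    by (intro bexI[OF _ uniform_limits_power_sum[OF u, of a n]]) auto
qed

text \<open>Without constants, \<open>g - g s\<close> may fall outside \<open>A\<close>; multiplied
  by an \<open>h\<close> in \<open>A\<close> with \<open>h t \<noteq> 0\<close> it lies in
  \<open>A\<close>. For \<open>s\<close> in \<open>S\<close>, any member of \<open>A\<close> that is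
  nonzero at \<open>t\<close> works.\<close>

lemma two_point_separation:
  assumes t: "t \<notin> S" and s: "s \<noteq> t"
  obtains f where "f \<in> A" "f t \<noteq> 0" "f s = 0"
proof (cases "s \<in> S")
  case True
  then show thesis using nonvanishing[OF t] vanishes that by blast
next
  case False
  obtain h where h: "h \<in> A" "h t \<noteq> 0" using nonvanishing[OF t] by blast
  obtain g where g: "g \<in> A" "g s \<noteq> g t" using separates[OF False t s] by blast
  have "(\<lambda>x. g x * h x + (- g s) * h x) \<in> A"
    by (intro add_mem mult_mem scale_mem g h)
  moreover have "g t * h t + (- g s) * h t \<noteq> 0"
    using h g by (simp add: left_diff_distrib[symmetric])
  ultimately show thesis by (intro that[of "\<lambda>x. g x * h x + (- g s) * h x"]) auto
qed

text \<open>Self-adjointness puts \<open>u\<close>, the square of \<open>|f / f t|\<close>, into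
  \<open>A\<close>. The clamp \<open>F\<close> is 0 below 1/3 and 1 above 2/3, so \<open>F\<close>
  after \<open>u\<close> is constant on open neighbourhoods both of \<open>t\<close> and of the zero
  set of \<open>f\<close>.\<close>

lemma local_bump:
  assumes f: "f \<in> A" "f t \<noteq> 0"
  obtains h N U where "h \<in> uniform_limits" "\<And>x. 0 \<le> h x" "\<And>x. h x \<le> 1"
    "open N" "t \<in> N" "\<And>x. x \<in> N \<Longrightarrow> h x = 1"
    "open U" "{x. f x = 0} \<subseteq> U" "\<And>x. x \<in> U \<Longrightarrow> h x = 0"
proof -
  define u where "u x = (cmod (f x) / cmod (f t))\<^sup>2" for x
  define F :: "real \<Rightarrow> real" where "F y = max 0 (min 1 (3 * y - 1))" for y
  have "(\<lambda>x. of_real (inverse ((cmod (f t))\<^sup>2)) * (f x * cnj (f x))) \<in> A"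
    by (intro scale_mem mult_mem cnj_mem f)
  also have "(\<lambda>x. of_real (inverse ((cmod (f t))\<^sup>2)) * (f x * cnj (f x))) = (\<lambda>x. of_real (u x))"
    unfolding u_def by (auto simp: fun_eq_iff complex_norm_square[symmetric] field_simps)
  finally have u: "u \<in> uniform_limits" by (rule mem_uniform_limits)
  have cont: "continuous_on UNIV u"
    unfolding u_def using f by (intro continuous_intros continuous) auto
  have "continuous_on UNIV F" unfolding F_def by (intro continuous_intros)
  then have "(\<lambda>x. F (u x)) \<in> uniform_limits"
    by (rule uniform_limits_compose[OF u]) (simp add: F_def)
  moreover have "open {x. 2 / 3 < u x}" "open {x. u x < 1 / 3}"
    by (intro open_Collect_less cont continuous_intros)+
  moreover have "u t = 1" using f by (simp add: u_def)
  ultimately show thesis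
    by (intro that[of "\<lambda>x. F (u x)" "{x. 2 / 3 < u x}" "{x. u x < 1 / 3}"])
      (auto simp: F_def u_def)
qed

text \<open>Compactness of \<open>C\<close> replaces a separation axiom: finitely many of the open
  zero sets cover \<open>C\<close>. The product of their bumps vanishes on all of them and is 1 on a
  finite intersection of neighbourhoods of \<open>t\<close>.\<close>

lemma bump:
  assumes t: "t \<notin> S" and C: "compact C" "t \<notin> C"
  obtains h N where "h \<in> uniform_limits" "\<And>x. 0 \<le> h x" "\<And>x. h x \<le> 1"
    "open N" "t \<in> N" "\<And>x. x \<in> N \<Longrightarrow> h x = 1" "\<And>x. x \<in> C \<Longrightarrow> h x = 0"
proof -
  define P where "P h N U \<longleftrightarrow> h \<in> uniform_limits \<and> (\<forall>x. 0 \<le> h x \<and> h x \<le> 1) \<and> open N \<and> t \<in> N \<and>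
    (\<forall>x\<in>N. h x = 1) \<and> (\<forall>x\<in>U. h x = 0)" for h :: "'a \<Rightarrow> real" and N U
  have "\<exists>U. open U \<and> s \<in> U \<and> (\<exists>h N. P h N U)" if "s \<in> C" for s
  proof -
    have "s \<noteq> t" using that C by blast
    then obtain f where f: "f \<in> A" "f t \<noteq> 0" "f s = 0" using two_point_separation[OF t] by blast
    show ?thesis using local_bump[OF f(1,2)] f(3) unfolding P_def
      by (smt (verit, best) mem_Collect_eq subsetD)
  qed
  then obtain U where U: "\<And>s. s \<in> C \<Longrightarrow> open (U s) \<and> s \<in> U s \<and> (\<exists>h N. P h N (U s))" by metis
  obtain D where D: "D \<subseteq> C" "finite D" "C \<subseteq> (\<Union>s\<in>D. U s)"
    using compactE_image[OF C(1), of C U] U by (metis UN_iff subsetI)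
  have "\<exists>h N. P h N (\<Union>s\<in>D. U s)" using D(2,1)
  proof (induction D rule: finite_induct)
    case empty
    \<comment> \<open>The empty product would be the constant 1, which need not be a uniform limit;
      any local bump at \<open>t\<close> serves instead.\<close>
    obtain f where f: "f \<in> A" "f t \<noteq> 0" using nonvanishing[OF t] by blast
    show ?case using local_bump[OF f] unfolding P_def by (metis UN_empty empty_iff)
  next
    case (insert s D)
    then obtain h N where h: "P h N (\<Union>s\<in>D. U s)" by auto
    obtain k N' where k: "P k N' (U s)" using U[of s] insert.prems by blast
    have "P (\<lambda>x. h x * k x) (N \<inter> N') (\<Union>s\<in>insert s D. U s)"
      using h k unfolding P_def by (auto intro: uniform_limits_mult mult_le_one)
    then show ?case by blast
  qed
  then obtain h N where "P h N (\<Union>s\<in>D. U s)" by blast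
  then show thesis using D(3) unfolding P_def by (intro that[of h N]) auto
qed

end

text \<open>The gluing step is convex: with \<open>\<phi>' = h + (1 - h) \<phi>\<close> and \<open>\<gamma>' = h g + (1 - h) \<gamma>\<close> one has
  \<open>\<gamma>' - \<phi>' f = h (g - f) + (1 - h) (\<gamma> - \<phi> f)\<close>, so the bound \<open>v p (\<gamma> - \<phi> f) \<le> e \<phi>\<close> is inherited and
  no estimate depends on the number of pieces. The compactness hypotheses stand in for upper
  semicontinuity of \<open>v\<close>, which fails for the indicator function of a compact set that is not closed.\<close>

lemma (in separating_algebra) weighted_approximation:
  fixes smult_X :: "complex \<Rightarrow> 'x::ab_group_add \<Rightarrow> 'x" and G :: "('a \<Rightarrow> 'x) set"
  assumes X: "vector_space smult_X" and p: "seminorm smult_X p"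
    and v: "\<And>x. 0 \<le> v x" and T: "\<And>x. v x \<noteq> 0 \<Longrightarrow> x \<in> T"
    and G: "function_subspace smult_X G"
    and AG: "\<And>\<phi> g. \<phi> \<in> A \<Longrightarrow> g \<in> G \<Longrightarrow> (\<lambda>x. smult_X (\<phi> x) (g x)) \<in> G"
    and dense: "\<And>t y e. t \<notin> S \<Longrightarrow> 0 < e \<Longrightarrow> \<exists>g\<in>G. p (g t - y) < e"
    and bdd: "\<And>g. g \<in> G \<Longrightarrow> \<exists>M. \<forall>x. v x * p (g x) \<le> M"
    and compact_diff: "\<And>g e. g \<in> G \<Longrightarrow> 0 < e \<Longrightarrow> compact {x. e \<le> v x * p (g x - f x)}"
    and compact_f: "\<And>e. 0 < e \<Longrightarrow> compact {x. e \<le> v x * p (f x)}"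
    and f0: "\<And>x. x \<in> S \<Longrightarrow> f x = 0"
    and e: "0 < e"
  shows "\<exists>g\<in>G. \<forall>x. v x * p (g x - f x) \<le> e"
proof -
  interpret vector_space smult_X by (rule X)
  note p0 = seminorm_zero[OF X p] and padd = seminorm_add[OF p] and pscale = seminorm_scale[OF p]
    and pnn = seminorm_nonneg[OF p]
  note G' = G[unfolded function_subspace_iff[OF X]]
  have G_add: "(\<lambda>x. g x + h x) \<in> G" if "g \<in> G" "h \<in> G" for g h
    using G' that unfolding plus_fun_def by blast
  \<comment> \<open>\<open>H\<close> is the closure of \<open>G\<close> for this one weighted
    seminorm. It is stable under multiplication by \<open>uniform_limits\<close>, whereas
    \<open>G\<close> is only stable under \<open>A\<close>; hence the gluing takes place in
    \<open>H\<close>.\<close>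
  define H where "H = {\<gamma>. \<forall>e>0. \<exists>g\<in>G. \<forall>x. v x * p (g x - \<gamma> x) \<le> e}"
  have HE: "\<exists>g\<in>G. \<forall>x. v x * p (g x - \<gamma> x) \<le> e" if "\<gamma> \<in> H" "0 < e" for \<gamma> e
    using that unfolding H_def by blast
  have G_H: "g \<in> H" if "g \<in> G" for g
    unfolding H_def using that p0 by (auto intro!: bexI[of _ g])
  have H_add: "(\<lambda>x. \<gamma> x + \<delta> x) \<in> H" if \<gamma>: "\<gamma> \<in> H" and \<delta>: "\<delta> \<in> H" for \<gamma> \<delta>
    unfolding H_def
  proof clarify
    fix e :: real assume e: "0 < e"
    obtain g where g: "g \<in> G" "\<And>x. v x * p (g x - \<gamma> x) \<le> e / 2"
      using HE[OF \<gamma>, of "e / 2"] e by auto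
    obtain h where h: "h \<in> G" "\<And>x. v x * p (h x - \<delta> x) \<le> e / 2"
      using HE[OF \<delta>, of "e / 2"] e by auto
    have "v x * p (g x + h x - (\<gamma> x + \<delta> x)) \<le> e" for x
    proof -
      have "p (g x + h x - (\<gamma> x + \<delta> x)) \<le> p (g x - \<gamma> x) + p (h x - \<delta> x)"
        using padd[of "g x - \<gamma> x" "h x - \<delta> x"] by (simp add: algebra_simps)
      then have "v x * p (g x + h x - (\<gamma> x + \<delta> x)) \<le> v x * p (g x - \<gamma> x) + v x * p (h x - \<delta> x)"
        using mult_left_mono[OF _ v[of x]] by (metis distrib_left)
      then show ?thesis using g(2)[of x] h(2)[of x] by simp
    qed
    then show "\<exists>g\<in>G. \<forall>x. v x * p (g x - (\<gamma> x + \<delta> x)) \<le> e"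
      by (intro bexI[OF _ G_add[OF g(1) h(1)]]) auto
  qed
  have H_mult: "(\<lambda>x. smult_X (of_real (k x)) (\<gamma> x)) \<in> H" if k: "k \<in> uniform_limits" and \<gamma>: "\<gamma> \<in> H" for k \<gamma>
    unfolding H_def
  proof clarify
    fix e :: real assume e: "0 < e"
    obtain M where M: "0 < M" "\<And>x. x \<in> T \<Longrightarrow> \<bar>k x\<bar> \<le> M"
      using uniform_limits_bounded[OF k] by blast
    obtain g where g: "g \<in> G" "\<And>x. v x * p (g x - \<gamma> x) \<le> e / (2 * M)"
      using HE[OF \<gamma>, of "e / (2 * M)"] e M by auto
    obtain B where B: "\<And>x. v x * p (g x) \<le> B" using bdd[OF g(1)] by blast
    have B0: "0 \<le> B" using B[of undefined] mult_nonneg_nonneg[OF v pnn] by (meson order_trans)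
    obtain \<phi> where \<phi>: "\<phi> \<in> A" "\<And>x. x \<in> T \<Longrightarrow> cmod (\<phi> x - of_real (k x)) \<le> e / (2 * (B + 1))"
      using uniform_limitsE[OF k, of "e / (2 * (B + 1))"] e B0 by auto
    have "v x * p (smult_X (\<phi> x) (g x) - smult_X (of_real (k x)) (\<gamma> x)) \<le> e" for x
    \<comment> \<open>Off \<open>T\<close> nothing is known about \<open>\<phi> - k\<close>, but the
      weight vanishes there.\<close>
    proof (cases "v x = 0")
      case True
      then show ?thesis using e by simp
    next
      case False
      then have x: "x \<in> T" by (rule T)
      have "smult_X (\<phi> x) (g x) - smult_X (of_real (k x)) (\<gamma> x)
          = smult_X (\<phi> x - of_real (k x)) (g x) + smult_X (of_real (k x)) (g x - \<gamma> x)"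
        by (simp add: scale_left_diff_distrib scale_right_diff_distrib)
      then have "p (smult_X (\<phi> x) (g x) - smult_X (of_real (k x)) (\<gamma> x))
          \<le> cmod (\<phi> x - of_real (k x)) * p (g x) + \<bar>k x\<bar> * p (g x - \<gamma> x)"
        by (metis padd pscale norm_of_real)
      then have "v x * p (smult_X (\<phi> x) (g x) - smult_X (of_real (k x)) (\<gamma> x))
          \<le> v x * (cmod (\<phi> x - of_real (k x)) * p (g x) + \<bar>k x\<bar> * p (g x - \<gamma> x))"
        by (rule mult_left_mono[OF _ v])
      also have "\<dots> = cmod (\<phi> x - of_real (k x)) * (v x * p (g x)) + \<bar>k x\<bar> * (v x * p (g x - \<gamma> x))"
        by (simp add: algebra_simps)
      also have "\<dots> \<le> e / (2 * (B + 1)) * (B + 1) + M * (e / (2 * M))"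
      proof (intro add_mono mult_mono)
        show "v x * p (g x) \<le> B + 1" using B[of x] by simp
      qed (use \<phi>(2)[OF x] M(1) M(2)[OF x] g(2)[of x] e B0 v pnn in auto)
      also have "\<dots> = e" using M(1) B0 by (simp add: field_simps)
      finally show ?thesis .
    qed
    then show "\<exists>g\<in>G. \<forall>x. v x * p (g x - smult_X (of_real (k x)) (\<gamma> x)) \<le> e"
      by (intro bexI[OF _ AG[OF \<phi>(1) g(1)]]) auto
  qed
  \<comment> \<open>One half of \<open>e\<close> pays for the gluing and for what is neglected off
    \<open>K\<close>, the other for the return from \<open>H\<close> to \<open>G\<close>.\<close>
  define r where "r = e / 2"
  have r: "0 < r" using e by (simp add: r_def)
  define K where "K = {x. r \<le> v x * p (f x)}"
  have K: "compact K" unfolding K_def by (rule compact_f[OF r])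
  \<comment> \<open>The cutoff \<open>h\<close> may be nonzero only where \<open>g\<close> is
    already \<open>r\<close>-close to \<open>f\<close>.\<close>
  define P where "P g h N \<longleftrightarrow> g \<in> G \<and> h \<in> uniform_limits \<and> (\<forall>x. 0 \<le> h x \<and> h x \<le> 1) \<and>
    (\<forall>x\<in>N. h x = 1) \<and> (\<forall>x. h x \<noteq> 0 \<longrightarrow> v x * p (g x - f x) \<le> r)" for g h N
  have "\<exists>N. open N \<and> t \<in> N \<and> (\<exists>g h. P g h N)" if t: "t \<in> K" for t
  proof -
    have "v t \<noteq> 0" "t \<notin> S" using t r f0[of t] p0 unfolding K_def by auto
    then have vt: "0 < v t" using v[of t] by simp
    \<comment> \<open>Since \<open>v t\<close> is positive, this tolerance keeps \<open>t\<close>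
      outside the compact set where the weighted difference is at least \<open>r\<close>.\<close>
    obtain g where g: "g \<in> G" "p (g t - f t) < r / v t"
      using dense[OF \<open>t \<notin> S\<close>, of "r / v t" "f t"] r vt by auto
    have "t \<notin> {x. r \<le> v x * p (g x - f x)}" using g(2) vt by (simp add: field_simps)
    then obtain h N where h: "h \<in> uniform_limits" "\<And>x. 0 \<le> h x" "\<And>x. h x \<le> 1"
      and N: "open N" "t \<in> N" "\<And>x. x \<in> N \<Longrightarrow> h x = 1"
      and h0: "\<And>x. x \<in> {x. r \<le> v x * p (g x - f x)} \<Longrightarrow> h x = 0"
      using bump[OF \<open>t \<notin> S\<close> compact_diff[OF g(1) r]] by blast
    have "v x * p (g x - f x) \<le> r" if "h x \<noteq> 0" for x
      using h0[of x] that by (cases "r \<le> v x * p (g x - f x)") auto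
    then have "P g h N" unfolding P_def using g(1) h N(3) by blast
    then show ?thesis using \<open>open N\<close> \<open>t \<in> N\<close> by blast
  qed
  then obtain N where N: "\<And>t. t \<in> K \<Longrightarrow> open (N t) \<and> t \<in> N t \<and> (\<exists>g h. P g h (N t))" by metis
  obtain D where D: "D \<subseteq> K" "finite D" "K \<subseteq> (\<Union>t\<in>D. N t)"
    using compactE_image[OF K, of K N] N by (metis UN_iff subsetI)
  \<comment> \<open>\<open>\<phi>\<close> records which fraction of \<open>f\<close> has been
    approximated so far. The bound \<open>r * \<phi> x\<close> instead of \<open>r\<close> reserves
    \<open>r * (1 - \<phi> x)\<close> for the missing fraction.\<close>
  define Q where "Q \<gamma> \<phi> U \<longleftrightarrow> \<gamma> \<in> H \<and> \<phi> \<in> uniform_limits \<and> (\<forall>x. 0 \<le> \<phi> x \<and> \<phi> x \<le> 1) \<and>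
    (\<forall>x\<in>U. \<phi> x = 1) \<and> (\<forall>x. v x * p (\<gamma> x - smult_X (of_real (\<phi> x)) (f x)) \<le> r * \<phi> x)" for \<gamma> \<phi> U
  have "\<exists>\<gamma> \<phi>. Q \<gamma> \<phi> (\<Union>t\<in>D. N t)" using D(2,1)
  proof (induction D rule: finite_induct)
    case empty
    have "(0 :: 'a \<Rightarrow> 'x) \<in> H" using G_H G' by blast
    then have "Q 0 (\<lambda>x. 0) {}" unfolding Q_def by (simp add: uniform_limits_zero p0)
    then show ?case by auto
  next
    case (insert t D)
    then obtain \<gamma> \<phi> where Q: "Q \<gamma> \<phi> (\<Union>t\<in>D. N t)" by auto
    obtain g h where P: "P g h (N t)" using N[of t] insert.prems by blast
    \<comment> \<open>The convex combinations are written in expanded form, because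
      \<open>1 - h\<close> itself need not be a uniform limit.\<close>
    let ?\<phi> = "\<lambda>x. h x + (\<phi> x - h x * \<phi> x)"
    let ?\<gamma> = "\<lambda>x. smult_X (of_real (h x)) (g x) + (\<gamma> x + smult_X (of_real ((-1) * h x)) (\<gamma> x))"
    have Q1: "?\<gamma> \<in> H" using P Q unfolding P_def Q_def
      by (intro H_add H_mult uniform_limits_scale) (auto intro: G_H)
    have Q2: "?\<phi> \<in> uniform_limits" using P Q unfolding P_def Q_def
      by (intro uniform_limits_add uniform_limits_diff uniform_limits_mult) auto
    have Q3: "0 \<le> ?\<phi> x \<and> ?\<phi> x \<le> 1" for x
    proof -
      have "0 \<le> h x" "h x \<le> 1" "0 \<le> \<phi> x" "\<phi> x \<le> 1" using P Q unfolding P_def Q_def by auto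
      then have "0 \<le> (1 - h x) * \<phi> x" "0 \<le> (1 - h x) * (1 - \<phi> x)" by auto
      then show ?thesis using \<open>0 \<le> h x\<close> by (simp add: algebra_simps)
    qed
    have Q4: "?\<phi> x = 1" if "x \<in> (\<Union>t\<in>insert t D. N t)" for x
      using that P Q unfolding P_def Q_def by auto
    have Q5: "v x * p (?\<gamma> x - smult_X (of_real (?\<phi> x)) (f x)) \<le> r * ?\<phi> x" for x
    proof -
      have h: "0 \<le> h x" "h x \<le> 1" "h x \<noteq> 0 \<Longrightarrow> v x * p (g x - f x) \<le> r" using P unfolding P_def by auto
      have "?\<gamma> x - smult_X (of_real (?\<phi> x)) (f x) = smult_X (of_real (h x)) (g x - f x)
          + smult_X (of_real (1 - h x)) (\<gamma> x - smult_X (of_real (\<phi> x)) (f x))"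
        by (simp add: scale_left_diff_distrib scale_right_diff_distrib scale_left_distrib left_diff_distrib)
      then have "p (?\<gamma> x - smult_X (of_real (?\<phi> x)) (f x))
          \<le> h x * p (g x - f x) + (1 - h x) * p (\<gamma> x - smult_X (of_real (\<phi> x)) (f x))"
        using padd[of "smult_X (of_real (h x)) (g x - f x)"
            "smult_X (of_real (1 - h x)) (\<gamma> x - smult_X (of_real (\<phi> x)) (f x))"] h(1,2)
        by (simp add: pscale del: of_real_diff)
      then have "v x * p (?\<gamma> x - smult_X (of_real (?\<phi> x)) (f x))
          \<le> v x * (h x * p (g x - f x) + (1 - h x) * p (\<gamma> x - smult_X (of_real (\<phi> x)) (f x)))"
        by (rule mult_left_mono[OF _ v])
      also have "\<dots> = h x * (v x * p (g x - f x))
          + (1 - h x) * (v x * p (\<gamma> x - smult_X (of_real (\<phi> x)) (f x)))"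
        by (simp add: algebra_simps)
      also have "\<dots> \<le> h x * r + (1 - h x) * (r * \<phi> x)"
      proof (rule add_mono)
        \<comment> \<open>Where \<open>h\<close> vanishes, \<open>P\<close> says nothing about
          \<open>g - f\<close>, but both sides are 0.\<close>
        show "h x * (v x * p (g x - f x)) \<le> h x * r"
          using h by (cases "h x = 0") (auto intro: mult_left_mono)
        show "(1 - h x) * (v x * p (\<gamma> x - smult_X (of_real (\<phi> x)) (f x))) \<le> (1 - h x) * (r * \<phi> x)"
          using h Q unfolding Q_def by (intro mult_left_mono) auto
      qed
      also have "\<dots> = r * ?\<phi> x" by (simp add: algebra_simps)
      finally show ?thesis .
    qed
    have "Q ?\<gamma> ?\<phi> (\<Union>t\<in>insert t D. N t)"
      unfolding Q_def by (intro conjI[OF Q1] conjI[OF Q2] conjI[OF allI] conjI[OF ballI] allI Q3 Q4 Q5)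
    then show ?case by blast
  qed
  then obtain \<gamma> \<phi> where Q: "Q \<gamma> \<phi> (\<Union>t\<in>D. N t)" by blast
  then have "\<gamma> \<in> H" and \<gamma>: "\<And>x. v x * p (\<gamma> x - smult_X (of_real (\<phi> x)) (f x)) \<le> r * \<phi> x"
    and \<phi>: "\<And>x. \<phi> x \<le> 1" "\<And>x. x \<in> K \<Longrightarrow> \<phi> x = 1"
    using D(3) unfolding Q_def by auto
  obtain g where g: "g \<in> G" "\<And>x. v x * p (g x - \<gamma> x) \<le> r" using HE[OF \<open>\<gamma> \<in> H\<close> r] by blast
  have "v x * p (g x - f x) \<le> e" for x
  proof -
    let ?f = "smult_X (of_real (\<phi> x)) (f x)"
    \<comment> \<open>The missing part \<open>?d\<close> of \<open>f\<close> vanishes on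
      \<open>K\<close>, where \<open>\<phi>\<close> is 1; off \<open>K\<close> the weighted size of
      \<open>f\<close> is below \<open>r\<close>.\<close>
    let ?d = "smult_X (of_real (\<phi> x - 1)) (f x)"
    have eq: "g x - f x = (g x - \<gamma> x) + ((\<gamma> x - ?f) + ?d)"
      by (simp add: scale_left_diff_distrib)
    have "p ?d = (1 - \<phi> x) * p (f x)" using \<phi>(1)[of x] by (simp only: pscale norm_of_real) simp
    then have "p (g x - f x) \<le> p (g x - \<gamma> x) + (p (\<gamma> x - ?f) + (1 - \<phi> x) * p (f x))"
      unfolding eq using padd[of "g x - \<gamma> x" "(\<gamma> x - ?f) + ?d"] padd[of "\<gamma> x - ?f" ?d] by linarith
    then have "v x * p (g x - f x) \<le> v x * (p (g x - \<gamma> x) + (p (\<gamma> x - ?f) + (1 - \<phi> x) * p (f x)))"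
      by (rule mult_left_mono[OF _ v])
    also have "\<dots> = v x * p (g x - \<gamma> x) + (v x * p (\<gamma> x - ?f) + (1 - \<phi> x) * (v x * p (f x)))"
      by (simp add: algebra_simps)
    also have "\<dots> \<le> r + (r * \<phi> x + (1 - \<phi> x) * r)"
    proof (intro add_mono g \<gamma>)
      show "(1 - \<phi> x) * (v x * p (f x)) \<le> (1 - \<phi> x) * r"
        using \<phi>[of x] unfolding K_def
        by (cases "r \<le> v x * p (f x)") (auto intro: mult_left_mono)
    qed
    also have "\<dots> = e" by (simp add: r_def field_simps)
    finally show ?thesis .
  qed
  then show ?thesis using g(1) by blast
qed

section \<open>Upper semicontinuity and boundedness of weighted functions\<close>

lemma open_product_less:
  fixes v u :: "'a::topological_space \<Rightarrow> real"
  assumes "\<And>x. 0 \<le> v x" "\<And>x. 0 \<le> u x" "\<And>b. open {x. v x < b}" "\<And>b. open {x. u x < b}"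
  shows "open {x. v x * u x < a}"
proof (subst open_subopen, clarify)
  fix x assume x: "v x * u x < a"
  \<comment> \<open>As \<open>d \<le> 1\<close>, the product of \<open>v x + d\<close> and
    \<open>u x + d\<close> exceeds \<open>v x * u x\<close> by at most
    \<open>d * (v x + u x + 1)\<close>. Having 2 in the denominator leaves a margin
    \<open>d\<close>, which makes the bound strict.\<close>
  define d where "d = min 1 ((a - v x * u x) / (v x + u x + 2))"
  have pos: "0 < v x + u x + 2" using assms(1,2)[of x] by linarith
  then have d: "0 < d" "d \<le> 1" using x by (auto simp: d_def)
  have "d * (v x + u x + 2) \<le> (a - v x * u x) / (v x + u x + 2) * (v x + u x + 2)"
    using pos by (intro mult_right_mono) (auto simp: d_def)
  then have le: "d * (v x + u x + 2) \<le> a - v x * u x" using pos by simp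
  have "d * d \<le> d" using d by (simp add: mult_left_le)
  moreover have "(v x + d) * (u x + d) = v x * u x + d * (v x + u x + 2) + d * d - 2 * d"
    by (simp add: algebra_simps)
  ultimately have bound: "(v x + d) * (u x + d) < a" using le d by linarith
  have "{y. v y < v x + d} \<inter> {y. u y < u x + d} \<subseteq> {y. v y * u y < a}"
  proof clarify
    fix y assume "v y < v x + d" "u y < u x + d"
    then have "v y * u y \<le> (v x + d) * (u x + d)"
      using assms(1,2)[of y] by (intro mult_mono) auto
    then show "v y * u y < a" using bound by simp
  qed
  then show "\<exists>T. open T \<and> x \<in> T \<and> T \<subseteq> {x. v x * u x < a}"
    using assms(3)[of "v x + d"] assms(4)[of "u x + d"] d
    by (intro exI[of _ "{y. v y < v x + d} \<inter> {y. u y < u x + d}"]) auto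
qed

text \<open>On the compact set finitely many of the open sets \<open>{x. q x < real n}\<close>
  suffice; elsewhere 1 is a bound.\<close>

lemma bounded_above_of_compact_superlevel:
  fixes q :: "'a::topological_space \<Rightarrow> real"
  assumes op: "\<And>a. open {x. q x < a}" and "compact {x. 1 \<le> q x}"
  obtains M where "\<And>x. q x \<le> M"
proof -
  have "{x. 1 \<le> q x} \<subseteq> (\<Union>n\<in>UNIV. {x. q x < real n})" using reals_Archimedean2 by auto
  then obtain D where D: "finite D" "{x. 1 \<le> q x} \<subseteq> (\<Union>n\<in>D. {x. q x < real n})"
    using compactE_image[OF assms(2), of UNIV "\<lambda>n. {x. q x < real n}"] op by metis
  have "q x \<le> max 1 (Max (real ` D))" for x
  proof (cases "1 \<le> q x")
    case True
    then obtain n where "n \<in> D" "q x < real n" using D by auto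
    then show ?thesis using D(1) by (intro max.coboundedI2) (auto intro: Max_ge order_trans[OF less_imp_le])
  qed auto
  then show thesis by (rule that)
qed

text \<open>Continuity into the seminorm topology enters only through this upper semicontinuity.\<close>

lemma open_seminorm_less:
  assumes p: "p \<in> \<P>" "\<And>y. 0 \<le> p y" and f: "f \<in> continuous_maps \<P>"
  shows "open {x. p (f x) < a}"
proof (cases "0 < a")
  case True
  have "openin (seminorm_topology \<P>) {y. p (y - 0) < a}"
    unfolding seminorm_topology_def using p True by (intro topology_generated_by_Basis) blast
  moreover have "continuous_map euclidean (seminorm_topology \<P>) f"
    using f by (simp add: continuous_maps_def)
  ultimately have "openin euclidean {x \<in> topspace euclidean. f x \<in> {y. p (y - 0) < a}}"
    using openin_continuous_map_preimage by blast
  then show ?thesis by simp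
next
  case False
  then have "{x. p (f x) < a} = {}" using p(2) by (auto simp: not_less intro: order_trans)
  then show ?thesis by simp
qed

section \<open>The weighted space and its topology\<close>

locale weighted_space =
  fixes smult_X :: "complex \<Rightarrow> 'x::ab_group_add \<Rightarrow> 'x" and \<P> :: "('x \<Rightarrow> real) set"
    and V :: "('a::topological_space \<Rightarrow> real) set" and W :: "('a \<Rightarrow> 'x) set"
  assumes vector_space: "vector_space smult_X"
    and seminorm: "p \<in> \<P> \<Longrightarrow> seminorm smult_X p"
    and nachbin: "nachbin_family V"
    and W_continuous: "W \<subseteq> continuous_maps \<P>"
    and W_subspace: "function_subspace smult_X W"
begin

lemma weight_nonneg: "v \<in> V \<Longrightarrow> 0 \<le> v x"
  using nachbin by (simp add: nachbin_family_def)

lemma weighted_nonneg: "v \<in> V \<Longrightarrow> p \<in> \<P> \<Longrightarrow> 0 \<le> v x * p y"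
  using weight_nonneg seminorm_nonneg[OF seminorm] by simp

lemma open_weighted_less:
  assumes "f \<in> W" "v \<in> V" "p \<in> \<P>"
  shows "open {x. v x * p (f x) < a}"
proof (rule open_product_less)
  show "open {x. v x < b}" for b
    using nachbin assms by (simp add: nachbin_family_def upper_semicontinuous_def)
  show "open {x. p (f x) < b}" for b
    using open_seminorm_less[OF assms(3) seminorm_nonneg[OF seminorm[OF assms(3)]]] W_continuous assms(1)
    by blast
qed (use assms weight_nonneg seminorm_nonneg[OF seminorm] in auto)

lemma CV0_compact:
  "f \<in> CV0 \<P> V W \<Longrightarrow> v \<in> V \<Longrightarrow> p \<in> \<P> \<Longrightarrow> 0 < e \<Longrightarrow> compact {x. e \<le> v x * p (f x)}"
  by (simp add: CV0_def)

lemma CV0_bounded: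
  assumes "f \<in> CV0 \<P> V W" "v \<in> V" "p \<in> \<P>"
  obtains M where "\<And>x. v x * p (f x) \<le> M"
proof -
  have "f \<in> W" using assms(1) by (simp add: CV0_def)
  then show thesis
    using bounded_above_of_compact_superlevel[OF open_weighted_less[OF _ assms(2,3)]
        CV0_compact[OF assms zero_less_one]] that by blast
qed

text \<open>This serves sums and differences alike. Where \<open>h\<close> has weighted size at
  least \<open>e\<close>, one of \<open>f\<close> and \<open>g\<close> has at least
  \<open>e / 2\<close>, so the set lies in a union of two compact sets. It is closed by upper
  semicontinuity, hence compact, even though compact sets need not be closed here.\<close>

lemma CV0_combine:
  assumes "f \<in> CV0 \<P> V W" "g \<in> CV0 \<P> V W" "h \<in> W"
    and le: "\<And>p x. p \<in> \<P> \<Longrightarrow> p (h x) \<le> p (f x) + p (g x)"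
  shows "h \<in> CV0 \<P> V W"
  unfolding CV0_def
proof (intro CollectI conjI ballI allI impI)
  show "h \<in> W" by fact
  fix v p and e :: real assume v: "v \<in> V" and p: "p \<in> \<P>" and e: "0 < e"
  have "compact ({x. e / 2 \<le> v x * p (f x)} \<union> {x. e / 2 \<le> v x * p (g x)})"
    using CV0_compact[OF assms(1) v p, of "e / 2"] CV0_compact[OF assms(2) v p, of "e / 2"] e
    by (intro compact_Un) auto
  moreover have "closed {x. e \<le> v x * p (h x)}"
    using open_weighted_less[OF assms(3) v p, of e] by (simp add: closed_def Collect_neg_eq[symmetric] not_le)
  ultimately have "compact (({x. e / 2 \<le> v x * p (f x)} \<union> {x. e / 2 \<le> v x * p (g x)})
      \<inter> {x. e \<le> v x * p (h x)})"
    by (rule compact_Int_closed)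
  moreover have "e / 2 \<le> v x * p (f x) \<or> e / 2 \<le> v x * p (g x)" if x: "e \<le> v x * p (h x)" for x
  proof -
    have "v x * p (h x) \<le> v x * p (f x) + v x * p (g x)"
      using mult_left_mono[OF le[OF p] weight_nonneg[OF v], of x x] by (simp add: distrib_left)
    then show ?thesis using x by linarith
  qed
  then have "({x. e / 2 \<le> v x * p (f x)} \<union> {x. e / 2 \<le> v x * p (g x)})
      \<inter> {x. e \<le> v x * p (h x)} = {x. e \<le> v x * p (h x)}" by auto
  ultimately show "compact {x. e \<le> v x * p (h x)}" by simp
qed

lemma CV0_add:
  assumes "f \<in> CV0 \<P> V W" "g \<in> CV0 \<P> V W"
  shows "f + g \<in> CV0 \<P> V W"
proof (rule CV0_combine[OF assms])
  have "f \<in> W" "g \<in> W" using assms by (simp_all add: CV0_def)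
  then show "f + g \<in> W"
    using W_subspace[unfolded function_subspace_iff[OF vector_space]] by blast
qed (simp add: seminorm_add[OF seminorm])

lemma CV0_diff:
  assumes "f \<in> CV0 \<P> V W" "g \<in> CV0 \<P> V W"
  shows "f - g \<in> CV0 \<P> V W"
proof (rule CV0_combine[OF assms])
  have "f \<in> W" "g \<in> W" using assms by (simp_all add: CV0_def)
  then show "f - g \<in> W" by (rule function_subspace_diff[OF vector_space W_subspace])
qed (simp add: seminorm_diff[OF vector_space seminorm])

lemma CV0_zero: "0 \<in> CV0 \<P> V W"
proof -
  have "0 \<in> W" using W_subspace[unfolded function_subspace_iff[OF vector_space]] by blast
  then show ?thesis by (simp add: CV0_def seminorm_zero[OF vector_space seminorm] not_le)
qed

lemma le_weighted_seminorm:
  assumes "f \<in> CV0 \<P> V W" "v \<in> V" "p \<in> \<P>"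
  shows "v x * p (f x) \<le> weighted_seminorm v p f"
proof -
  obtain M where "\<And>x. v x * p (f x) \<le> M" using CV0_bounded[OF assms] by blast
  then show ?thesis unfolding weighted_seminorm_def by (intro cSUP_upper bdd_aboveI2) auto
qed

lemma weighted_seminorm_le: "(\<And>x. v x * p (f x) \<le> M) \<Longrightarrow> weighted_seminorm v p f \<le> M"
  unfolding weighted_seminorm_def by (intro cSUP_least) auto

lemma weighted_seminorm_add:
  assumes "f \<in> CV0 \<P> V W" "g \<in> CV0 \<P> V W" "v \<in> V" "p \<in> \<P>"
  shows "weighted_seminorm v p (f + g) \<le> weighted_seminorm v p f + weighted_seminorm v p g"
proof (rule weighted_seminorm_le)
  fix x
  have "v x * p ((f + g) x) \<le> v x * p (f x) + v x * p (g x)"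
    using mult_left_mono[OF seminorm_add[OF seminorm[OF assms(4)]] weight_nonneg[OF assms(3)], of x "f x" "g x"]
    by (simp add: distrib_left)
  also have "\<dots> \<le> weighted_seminorm v p f + weighted_seminorm v p g"
    using assms by (intro add_mono le_weighted_seminorm)
  finally show "v x * p ((f + g) x) \<le> weighted_seminorm v p f + weighted_seminorm v p g" .
qed

lemma topspace_CV0: "topspace (CV0_topology \<P> V W) = CV0 \<P> V W"
  unfolding CV0_topology_def topology_generated_by_topspace by blast

lemma openin_CV0_ball:
  assumes "f \<in> CV0 \<P> V W" "v \<in> V" "p \<in> \<P>" "0 < e"
  shows "openin (CV0_topology \<P> V W) {g \<in> CV0 \<P> V W. weighted_seminorm v p (g - f) < e}"
  unfolding CV0_topology_def by (rule topology_generated_by_Basis) (use assms in blast)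

text \<open>\<open>CV0_local_base\<close> speaks about neighbourhoods of 0 only; this carries a
  neighbourhood of \<open>f\<close> there. The property is checked on generators and passes to
  finite intersections and unions.\<close>

lemma openin_CV0_translate:
  assumes "openin (CV0_topology \<P> V W) U" "f \<in> U"
  obtains N where "openin (CV0_topology \<P> V W) N" "0 \<in> N" "\<And>h. h \<in> N \<Longrightarrow> f + h \<in> U"
proof -
  have "f \<in> U \<longrightarrow> (\<exists>N. openin (CV0_topology \<P> V W) N \<and> 0 \<in> N \<and> (\<forall>h\<in>N. f + h \<in> U))"
    using openin_topology_generated_by[OF assms(1)[unfolded CV0_topology_def]]
  proof (induction U rule: generate_topology_on.induct)
    case Empty
    then show ?case by simp
  next
    case (Int A B)
    show ?case
    proof
      assume "f \<in> A \<inter> B"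
      then have f: "f \<in> A" "f \<in> B" by auto
      obtain M where M: "openin (CV0_topology \<P> V W) M" "0 \<in> M" "\<forall>h\<in>M. f + h \<in> A"
        using Int.IH(1)[THEN mp, OF f(1)] by (elim exE conjE)
      obtain N where N: "openin (CV0_topology \<P> V W) N" "0 \<in> N" "\<forall>h\<in>N. f + h \<in> B"
        using Int.IH(2)[THEN mp, OF f(2)] by (elim exE conjE)
      show "\<exists>N. openin (CV0_topology \<P> V W) N \<and> 0 \<in> N \<and> (\<forall>h\<in>N. f + h \<in> A \<inter> B)"
        using openin_Int[OF M(1) N(1)] M(2,3) N(2,3) by (intro exI[of _ "M \<inter> N"]) simp
    qed
  next
    case (UN K)
    show ?case
    proof
      assume "f \<in> \<Union>K"
      then obtain k where k: "k \<in> K" "f \<in> k" by blast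
      obtain N where "openin (CV0_topology \<P> V W) N" "0 \<in> N" "\<forall>h\<in>N. f + h \<in> k"
        using UN.IH[OF k(1), THEN mp, OF k(2)] by (elim exE conjE)
      then show "\<exists>N. openin (CV0_topology \<P> V W) N \<and> 0 \<in> N \<and> (\<forall>h\<in>N. f + h \<in> \<Union>K)"
        using k(1) by (intro exI[of _ N]) auto
    qed
  next
    case (Basis s)
    show ?case
    proof
      assume fs: "f \<in> s"
      consider "s = CV0 \<P> V W" | f0 v p e where "f0 \<in> CV0 \<P> V W" "v \<in> V" "p \<in> \<P>" "0 < e"
        "s = {g \<in> CV0 \<P> V W. weighted_seminorm v p (g - f0) < e}" using Basis by blast
      then show "\<exists>N. openin (CV0_topology \<P> V W) N \<and> 0 \<in> N \<and> (\<forall>h\<in>N. f + h \<in> s)"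
      proof cases
        case 1
        then show ?thesis using fs CV0_add CV0_zero openin_topspace[of "CV0_topology \<P> V W"]
          by (intro exI[of _ "CV0 \<P> V W"]) (auto simp: topspace_CV0)
      next
        case 2
        \<comment> \<open>\<open>d\<close> is the slack of \<open>f\<close> inside the ball; by
          subadditivity, adding an \<open>h\<close> of weighted seminorm below \<open>d\<close>
          stays inside.\<close>
        define d where "d = e - weighted_seminorm v p (f - f0)"
        have f: "f \<in> CV0 \<P> V W" and d: "0 < d" using fs 2 by (auto simp: d_def)
        let ?N = "{h \<in> CV0 \<P> V W. weighted_seminorm v p (h - 0) < d}"
        have "openin (CV0_topology \<P> V W) ?N" by (rule openin_CV0_ball[OF CV0_zero 2(2,3) d])
        moreover have "weighted_seminorm v p 0 \<le> 0"
          by (rule weighted_seminorm_le) (simp add: seminorm_zero[OF vector_space seminorm[OF 2(3)]])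
        then have "0 \<in> ?N" using d CV0_zero by simp
        moreover have "f + h \<in> s" if h: "h \<in> ?N" for h
        proof -
          have "weighted_seminorm v p ((f - f0) + h) \<le> weighted_seminorm v p (f - f0) + weighted_seminorm v p h"
            using h 2 f by (intro weighted_seminorm_add CV0_diff) auto
          also have "\<dots> < e" using h by (simp add: d_def)
          also have "(f - f0) + h = f + h - f0" by simp
          finally show ?thesis using h 2(5) CV0_add[OF f] by blast
        qed
        ultimately show ?thesis by blast
      qed
    qed
  qed
  then show thesis using assms(2) that by blast
qed

text \<open>After translation to 0, the local base reduces an arbitrary neighbourhood to a single
  pair \<open>v\<close>, \<open>p\<close>, so approximation in one weighted seminorm at a time is
  enough.\<close>

lemma CV0_closureI:
  assumes base: "CV0_local_base \<P> V W" and f: "f \<in> CV0 \<P> V W" and G: "G \<subseteq> CV0 \<P> V W"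
    and approx: "\<And>v p e. v \<in> V \<Longrightarrow> p \<in> \<P> \<Longrightarrow> 0 < e \<Longrightarrow> \<exists>g\<in>G. \<forall>x. v x * p (g x - f x) \<le> e"
  shows "f \<in> (CV0_topology \<P> V W) closure_of G"
  unfolding in_closure_of
proof (intro conjI allI impI)
  show "f \<in> topspace (CV0_topology \<P> V W)" using f by (simp add: topspace_CV0)
  fix U assume "f \<in> U \<and> openin (CV0_topology \<P> V W) U"
  then obtain N where N: "openin (CV0_topology \<P> V W) N" "0 \<in> N" "\<And>h. h \<in> N \<Longrightarrow> f + h \<in> U"
    using openin_CV0_translate by blast
  obtain v p e where vpe: "v \<in> V" "p \<in> \<P>" "0 < e" "{h \<in> CV0 \<P> V W. weighted_seminorm v p h < e} \<subseteq> N"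
    using base[unfolded CV0_local_base_def neighbourhood_base_at_def, rule_format, OF conjI[OF N(1,2)]] by blast
  \<comment> \<open>Pointwise bounds yield only a non-strict bound on the supremum, hence
    \<open>e / 2\<close>.\<close>
  obtain g where g: "g \<in> G" "\<And>x. v x * p (g x - f x) \<le> e / 2"
    using approx[OF vpe(1,2), of "e / 2"] vpe(3) by auto
  have "weighted_seminorm v p (g - f) \<le> e / 2" by (rule weighted_seminorm_le) (use g(2) in simp)
  moreover have "g - f \<in> CV0 \<P> V W" using CV0_diff[OF _ f] g(1) G by blast
  ultimately have "g - f \<in> N" using vpe(3) by (intro subsetD[OF vpe(4)]) simp
  then have "f + (g - f) \<in> U" by (rule N(3))
  then show "\<exists>y. y \<in> G \<and> y \<in> U" using g(1) by auto
qed

text \<open>Otherwise the ball around \<open>h\<close> with radius \<open>v x * p (h x)\<close>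
  meets \<open>G\<close> in some \<open>g\<close>. But \<open>g x = 0\<close>, so
  \<open>g - h\<close> already has that weighted size at \<open>x\<close>.\<close>

lemma CV0_closure_weighted_zero:
  assumes h: "h \<in> (CV0_topology \<P> V W) closure_of G" and G: "G \<subseteq> CV0 \<P> V W" "\<And>g. g \<in> G \<Longrightarrow> g x = 0"
    and v: "v \<in> V" and p: "p \<in> \<P>"
  shows "v x * p (h x) = 0"
proof (rule ccontr)
  assume "v x * p (h x) \<noteq> 0"
  then have pos: "0 < v x * p (h x)" using weighted_nonneg[OF v p, of x "h x"] by linarith
  have hC: "h \<in> CV0 \<P> V W" using h by (simp add: in_closure_of topspace_CV0)
  have "weighted_seminorm v p (h - h) \<le> 0"
    by (rule weighted_seminorm_le) (simp add: seminorm_zero[OF vector_space seminorm[OF p]])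
  then have mem: "h \<in> {g \<in> CV0 \<P> V W. weighted_seminorm v p (g - h) < v x * p (h x)}" using hC pos by simp
  obtain g where g: "g \<in> G" "g \<in> {g \<in> CV0 \<P> V W. weighted_seminorm v p (g - h) < v x * p (h x)}"
    using h[unfolded in_closure_of, THEN conjunct2, rule_format, OF conjI[OF mem openin_CV0_ball[OF hC v p pos]]]
    by (elim exE conjE)
  have "g - h \<in> CV0 \<P> V W" using g(1) G(1) CV0_diff[OF _ hC] by blast
  from le_weighted_seminorm[OF this v p, of x]
  show False using g(2) G(2)[OF g(1)] seminorm_minus[OF vector_space seminorm[OF p]] by simp
qed

end

section \<open>Neighbourhoods in the compact-open topology\<close>

lemma openin_compact_open_ball:
  assumes "\<phi> \<in> complex_continuous_maps" "compact K" "0 < e"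
  shows "openin compact_open_topology {\<psi> \<in> complex_continuous_maps. \<forall>x\<in>K. cmod (\<psi> x - \<phi> x) < e}"
  unfolding compact_open_topology_def by (rule topology_generated_by_Basis) (use assms in blast)

lemma topspace_compact_open: "topspace compact_open_topology = complex_continuous_maps"
proof
  have "(\<lambda>x. 0) \<in> complex_continuous_maps" by (simp add: complex_continuous_maps_def)
  \<comment> \<open>For the empty compact set the subbasic ball is the whole function space.\<close>
  from openin_subset[OF openin_compact_open_ball[OF this compact_empty zero_less_one]]
  show "complex_continuous_maps \<subseteq> topspace compact_open_topology" by simp
  show "topspace compact_open_topology \<subseteq> complex_continuous_maps"
    unfolding compact_open_topology_def topology_generated_by_topspace by blast
qed

text \<open>Generators are recentred at \<open>f\<close>, and finite intersections are absorbed by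
  uniting the compact sets and shrinking the radius; so the balls around \<open>f\<close> form a
  local base.\<close>

lemma compact_open_neighbourhood:
  assumes "openin compact_open_topology U" "f \<in> U"
  obtains K e where "compact K" "0 < e"
    "{\<psi> \<in> complex_continuous_maps. \<forall>x\<in>K. cmod (\<psi> x - f x) < e} \<subseteq> U"
proof -
  have fc: "f \<in> complex_continuous_maps"
    using assms openin_subset[OF assms(1)] by (auto simp: topspace_compact_open)
  have "f \<in> U \<longrightarrow> (\<exists>K e. compact K \<and> 0 < e \<and>
      {\<psi> \<in> complex_continuous_maps. \<forall>x\<in>K. cmod (\<psi> x - f x) < e} \<subseteq> U)"
    using openin_topology_generated_by[OF assms(1)[unfolded compact_open_topology_def]]
  proof (induction U rule: generate_topology_on.induct)
    case Empty
    then show ?case by simp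
  next
    case (Int A B)
    show ?case
    proof
      assume "f \<in> A \<inter> B"
      then have f: "f \<in> A" "f \<in> B" by auto
      obtain K d where K:
        "compact K" "0 < d" "{\<psi> \<in> complex_continuous_maps. \<forall>x\<in>K. cmod (\<psi> x - f x) < d} \<subseteq> A"
        using Int.IH(1)[THEN mp, OF f(1)] by (elim exE conjE)
      obtain L e where L:
        "compact L" "0 < e" "{\<psi> \<in> complex_continuous_maps. \<forall>x\<in>L. cmod (\<psi> x - f x) < e} \<subseteq> B"
        using Int.IH(2)[THEN mp, OF f(2)] by (elim exE conjE)
      show "\<exists>K e. compact K \<and> 0 < e \<and>
          {\<psi> \<in> complex_continuous_maps. \<forall>x\<in>K. cmod (\<psi> x - f x) < e} \<subseteq> A \<inter> B"
        using compact_Un[OF K(1) L(1)] K(2,3) L(2,3)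
        by (intro exI[of _ "K \<union> L"] exI[of _ "min d e"]) (auto simp: subset_iff)
    qed
  next
    case (UN K)
    show ?case
    proof
      assume "f \<in> \<Union>K"
      then obtain k where k: "k \<in> K" "f \<in> k" by blast
      obtain L e where "compact L" "0 < e"
        "{\<psi> \<in> complex_continuous_maps. \<forall>x\<in>L. cmod (\<psi> x - f x) < e} \<subseteq> k"
        using UN.IH[OF k(1), THEN mp, OF k(2)] by (elim exE conjE)
      then show "\<exists>L e. compact L \<and> 0 < e \<and>
          {\<psi> \<in> complex_continuous_maps. \<forall>x\<in>L. cmod (\<psi> x - f x) < e} \<subseteq> \<Union>K"
        using Union_upper[OF k(1)] by (intro exI[of _ L] exI[of _ e]) simp
    qed
  next
    case (Basis s)
    show ?case
    proof
      assume fs: "f \<in> s"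
      obtain \<phi> K e where s: "\<phi> \<in> complex_continuous_maps" "compact K" "0 < e"
        "s = {\<psi> \<in> complex_continuous_maps. \<forall>x\<in>K. cmod (\<psi> x - \<phi> x) < e}" using Basis by blast
      \<comment> \<open>The maximum of \<open>|f - \<phi>|\<close> over a nonempty compact
        \<open>K\<close> is below \<open>e\<close>, which gives a uniform slack; for empty
        \<open>K\<close> any positive \<open>d\<close> works.\<close>
      have "\<exists>d>0. \<forall>x\<in>K. cmod (f x - \<phi> x) \<le> e - d"
      proof (cases "K = {}")
        case True
        then show ?thesis by (intro exI[of _ 1]) simp
      next
        case False
        have "continuous_on K (\<lambda>x. cmod (f x - \<phi> x))"
          using fc s(1) unfolding complex_continuous_maps_def
          by (auto intro!: continuous_intros intro: continuous_on_subset)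
        then obtain y where y: "y \<in> K" "\<And>x. x \<in> K \<Longrightarrow> cmod (f x - \<phi> x) \<le> cmod (f y - \<phi> y)"
          using continuous_attains_sup[OF s(2) False] by blast
        then show ?thesis using fs s(4) by (intro exI[of _ "e - cmod (f y - \<phi> y)"]) auto
      qed
      then obtain d where d: "0 < d" "\<And>x. x \<in> K \<Longrightarrow> cmod (f x - \<phi> x) \<le> e - d" by blast
      have "{\<psi> \<in> complex_continuous_maps. \<forall>x\<in>K. cmod (\<psi> x - f x) < d} \<subseteq> s"
      proof clarify
        fix \<psi> assume \<psi>: "\<psi> \<in> complex_continuous_maps" "\<forall>x\<in>K. cmod (\<psi> x - f x) < d"
        have "cmod (\<psi> x - \<phi> x) < e" if "x \<in> K" for x
          using \<psi>(2)[rule_format, OF that] d(2)[OF that]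
            norm_triangle_ineq[of "\<psi> x - f x" "f x - \<phi> x"] by simp
        then show "\<psi> \<in> s" using \<psi>(1) s(4) by simp
      qed
      then show "\<exists>K e. compact K \<and> 0 < e \<and>
          {\<psi> \<in> complex_continuous_maps. \<forall>x\<in>K. cmod (\<psi> x - f x) < e} \<subseteq> s"
        using s(2) d(1) by blast
    qed
  qed
  then show thesis using assms(2) that by blast
qed

section \<open>Complex values and indicator weights\<close>

lemma vector_space_complex: "vector_space ((*) :: complex \<Rightarrow> complex \<Rightarrow> complex)"
  by unfold_locales (auto simp: algebra_simps)

lemma seminorm_cmod: "seminorm (*) cmod"
  by (auto simp: seminorm_def norm_triangle_ineq norm_mult)

text \<open>As \<open>e\<close> is positive, points outside \<open>K\<close> drop out and a closed
  subset of \<open>K\<close> remains, which is compact even if \<open>K\<close> is not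
  closed.\<close>

lemma compact_superlevel_indicator:
  fixes h :: "'a::topological_space \<Rightarrow> complex"
  assumes "compact K" "continuous_on UNIV h" "0 < e"
  shows "compact {x. e \<le> indicator K x * cmod (h x)}"
proof -
  have "closed {x. e \<le> cmod (h x)}" using assms(2) by (intro closed_Collect_le continuous_intros)
  then have "compact (K \<inter> {x. e \<le> cmod (h x)})" by (rule compact_Int_closed[OF assms(1)])
  moreover have "{x. e \<le> indicator K x * cmod (h x)} = K \<inter> {x. e \<le> cmod (h x)}"
    using assms(3) by (intro set_eqI) (simp add: indicator_def)
  ultimately show ?thesis by simp
qed

text \<open>The claim about \<open>G\<close> is split: functions vanishing on \<open>S\<close>
  always lie in the closure, while the closure may also contain functions that are nonzero on
  \<open>S\<close> in a way no weighted seminorm sees.\<close>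

theorem theorem3p7:
  fixes smult_X :: "complex \<Rightarrow> 'x::ab_group_add \<Rightarrow> 'x"
    and \<P> :: "('x \<Rightarrow> real) set"
    and V :: "('a::topological_space \<Rightarrow> real) set"
    and W G :: "('a \<Rightarrow> 'x) set"
    and A :: "('a \<Rightarrow> complex) set"
    and S :: "'a set"
  assumes "vector_space smult_X"
    and "\<forall>p\<in>\<P>. seminorm smult_X p"
    and "nachbin_family V"
    and "W \<subseteq> continuous_maps \<P>" and "function_subspace smult_X W"
    and "CV0_local_base \<P> V W"
    and "function_subalgebra A" and "bounded_condition A V"
    and "closed S"
    and "G \<subseteq> CV0 \<P> V W" and "function_subspace smult_X G"
    and "\<forall>\<phi>\<in>A. \<forall>g\<in>G. (\<lambda>x. smult_X (\<phi> x) (g x)) \<in> G"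
    and "\<forall>g\<in>G. \<forall>x\<in>S. g x = 0"
    and i: "\<forall>f\<in>A. (\<lambda>x. cnj (f x)) \<in> A"
    and ii: "\<forall>x\<in>-S. \<forall>y\<in>-S. x \<noteq> y \<longrightarrow> (\<exists>\<phi>\<in>A. \<phi> x \<noteq> \<phi> y)"
    and iii: "\<forall>\<phi>\<in>A. \<forall>x\<in>S. \<phi> x = 0" "\<forall>t\<in>-S. \<exists>\<phi>\<in>A. \<phi> t \<noteq> 0"
    and iv: "\<forall>\<epsilon>>0. \<forall>p\<in>\<P>. \<forall>t\<in>-S. \<forall>y. \<exists>f\<in>G. p (f t - y) < \<epsilon>"
  shows "{f \<in> CV0 \<P> V W. \<forall>x\<in>S. f x = 0} \<subseteq> (CV0_topology \<P> V W) closure_of G \<and>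
         (weights_detect_zero_on \<P> V W S \<longrightarrow>
           (CV0_topology \<P> V W) closure_of G = {f \<in> CV0 \<P> V W. \<forall>x\<in>S. f x = 0}) \<and>
         compact_open_topology closure_of A =
           {\<phi> \<in> complex_continuous_maps. \<forall>x\<in>S. \<phi> x = 0}"
proof -
  interpret weighted_space smult_X \<P> V W using assms(1-5) by (simp add: weighted_space_def)
  note Asub = assms(7)[unfolded function_subalgebra_def function_subspace_iff[OF vector_space_complex]]
  have A_cont: "continuous_on UNIV \<phi>" if "\<phi> \<in> A" for \<phi>
    using Asub that by (auto simp: complex_continuous_maps_def)
  have A_subspace: "function_subspace (*) A" using assms(7) by (simp add: function_subalgebra_def)
  have sep: "separating_algebra A S T" if bdd: "\<And>f. f \<in> A \<Longrightarrow> bounded (f ` T)" for T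
  proof (rule separating_algebra.intro)
    show "(\<lambda>x. 0) \<in> A" using Asub by (simp add: zero_fun_def)
    show "(\<lambda>x. f x + g x) \<in> A" "(\<lambda>x. f x * g x) \<in> A" if "f \<in> A" "g \<in> A" for f g
      using Asub that by (auto simp: plus_fun_def times_fun_def)
    show "(\<lambda>x. c * f x) \<in> A" if "f \<in> A" for c f using Asub that by blast
  qed (use i ii iii A_cont bdd in auto)
  have part1: "{f \<in> CV0 \<P> V W. \<forall>x\<in>S. f x = 0} \<subseteq> (CV0_topology \<P> V W) closure_of G"
  proof clarify
    fix f assume f: "f \<in> CV0 \<P> V W" "\<forall>x\<in>S. f x = 0"
    show "f \<in> (CV0_topology \<P> V W) closure_of G"
    proof (rule CV0_closureI[OF assms(6) f(1) assms(10)])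
      fix v p and e :: real assume vpe: "v \<in> V" "p \<in> \<P>" "0 < e"
      interpret separating_algebra A S "supp v"
        by (rule sep) (use assms(8) vpe in \<open>auto simp: bounded_condition_def\<close>)
      show "\<exists>g\<in>G. \<forall>x. v x * p (g x - f x) \<le> e"
      proof (rule weighted_approximation[OF vector_space seminorm[OF vpe(2)] weight_nonneg[OF vpe(1)]
            _ assms(11) _ _ _ _ _ _ vpe(3), where f = f])
        show "x \<in> supp v" if "v x \<noteq> 0" for x using that closure_subset by (force simp: supp_def)
        show "(\<lambda>x. smult_X (\<phi> x) (g x)) \<in> G" if "\<phi> \<in> A" "g \<in> G" for \<phi> g using assms(12) that by blast
        show "\<exists>g\<in>G. p (g t - y) < e" if "t \<notin> S" "0 < e" for t y e using iv vpe(2) that by blast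
        show "\<exists>M. \<forall>x. v x * p (g x) \<le> M" if "g \<in> G" for g
          using CV0_bounded[of g v p] assms(10) that vpe by blast
        show "compact {x. e \<le> v x * p (g x - f x)}" if "g \<in> G" "0 < e" for g e
          using CV0_compact[OF CV0_diff[of g f] vpe(1,2)] f(1) assms(10) that by auto
        show "compact {x. e \<le> v x * p (f x)}" if "0 < e" for e by (rule CV0_compact[OF f(1) vpe(1,2) that])
        show "f x = 0" if "x \<in> S" for x using f(2) that by blast
      qed
    qed
  qed
  moreover have "(CV0_topology \<P> V W) closure_of G = {f \<in> CV0 \<P> V W. \<forall>x\<in>S. f x = 0}"
    if detect: "weights_detect_zero_on \<P> V W S"
  proof
    show "(CV0_topology \<P> V W) closure_of G \<subseteq> {f \<in> CV0 \<P> V W. \<forall>x\<in>S. f x = 0}"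
    proof
      fix h assume h: "h \<in> (CV0_topology \<P> V W) closure_of G"
      then have "h \<in> CV0 \<P> V W" by (simp add: in_closure_of topspace_CV0)
      \<comment> \<open>Membership in the closure controls only weighted values on \<open>S\<close>;
        \<open>detect\<close> turns this into vanishing.\<close>
      moreover have "v x * p (h x) = 0" if "x \<in> S" "v \<in> V" "p \<in> \<P>" for x v p
        using CV0_closure_weighted_zero[OF h assms(10)] assms(13) that by blast
      ultimately show "h \<in> {f \<in> CV0 \<P> V W. \<forall>x\<in>S. f x = 0}"
        using detect unfolding weights_detect_zero_on_def by blast
    qed
  qed (rule part1)
  moreover have "compact_open_topology closure_of A = {\<phi> \<in> complex_continuous_maps. \<forall>x\<in>S. \<phi> x = 0}"
  proof (intro equalityI subsetI)
    fix \<phi> assume \<phi>: "\<phi> \<in> compact_open_topology closure_of A"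
    then have c: "\<phi> \<in> complex_continuous_maps" by (simp add: in_closure_of topspace_compact_open)
    have "\<phi> x = 0" if x: "x \<in> S" for x
    proof (rule ccontr)
      assume "\<phi> x \<noteq> 0"
      then have pos: "0 < cmod (\<phi> x)" by simp
      \<comment> \<open>Members of \<open>A\<close> vanish at \<open>x\<close>, so none of them is
        closer to \<open>\<phi>\<close> than \<open>cmod (\<phi> x)\<close> on the compact set
        \<open>{x}\<close>.\<close>
      have mem: "\<phi> \<in> {\<psi> \<in> complex_continuous_maps. \<forall>y\<in>{x}. cmod (\<psi> y - \<phi> y) < cmod (\<phi> x)}"
        using c pos by simp
      have "compact {x}" by simp
      obtain \<psi> where \<psi>: "\<psi> \<in> A" "\<psi> \<in> {\<psi> \<in> complex_continuous_maps. \<forall>y\<in>{x}. cmod (\<psi> y - \<phi> y) < cmod (\<phi> x)}"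
        using \<phi>[unfolded in_closure_of, THEN conjunct2, rule_format,
            OF conjI[OF mem openin_compact_open_ball[OF c \<open>compact {x}\<close> pos]]]
        by (elim exE conjE)
      show False using iii(1)[rule_format, OF \<psi>(1) x] \<psi>(2) by simp
    qed
    then show "\<phi> \<in> {\<phi> \<in> complex_continuous_maps. \<forall>x\<in>S. \<phi> x = 0}" using c by blast
  next
    fix \<phi> assume \<phi>: "\<phi> \<in> {\<phi> \<in> complex_continuous_maps. \<forall>x\<in>S. \<phi> x = 0}"
    show "\<phi> \<in> compact_open_topology closure_of A"
      unfolding in_closure_of
    proof (intro conjI allI impI)
      show "\<phi> \<in> topspace compact_open_topology" using \<phi> by (simp add: topspace_compact_open)
      fix U assume "\<phi> \<in> U \<and> openin compact_open_topology U"
      then have U: "\<phi> \<in> U" "openin compact_open_topology U" by auto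
      obtain K e where K: "compact K" "0 < e"
        "{\<psi> \<in> complex_continuous_maps. \<forall>x\<in>K. cmod (\<psi> x - \<phi> x) < e} \<subseteq> U"
        by (rule compact_open_neighbourhood[OF U(2,1)])
      \<comment> \<open>On a compact set boundedness comes from continuity, so \<open>K\<close> can
        play the role of \<open>T\<close>.\<close>
      have A_bdd: "bounded (\<psi> ` K)" if "\<psi> \<in> A" for \<psi>
        using compact_continuous_image[OF continuous_on_subset[OF A_cont[OF that]] K(1)]
        by (simp add: compact_imp_bounded)
      interpret separating_algebra A S K by (rule sep[OF A_bdd])
      have \<phi>c: "continuous_on UNIV \<phi>" using \<phi> by (simp add: complex_continuous_maps_def)
      have "\<exists>\<psi>\<in>A. \<forall>x. indicator K x * cmod (\<psi> x - \<phi> x) \<le> e / 2"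
      proof (rule weighted_approximation[OF vector_space_complex seminorm_cmod, where f = \<phi> and G = A
            and v = "indicator K" and e = "e / 2"])
        show "\<exists>g\<in>A. cmod (g t - y) < e" if "t \<notin> S" "0 < e" for t y and e :: real
        proof -
          \<comment> \<open>A multiple of a function that is nonzero at \<open>t\<close> attains the
            value \<open>y\<close> there exactly.\<close>
          obtain g where "g \<in> A" "g t \<noteq> 0" using nonvanishing[OF \<open>t \<notin> S\<close>] by blast
          then show ?thesis using \<open>0 < e\<close> by (intro bexI[OF _ scale_mem[of g "y / g t"]]) auto
        qed
        show "\<exists>M. \<forall>x. indicator K x * cmod (g x) \<le> M" if "g \<in> A" for g
        proof -
          obtain M where "0 < M" "\<And>x. x \<in> K \<Longrightarrow> cmod (g x) \<le> M" using bounded_mem[OF \<open>g \<in> A\<close>] by blast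
          then show ?thesis by (intro exI[of _ M]) (auto simp: indicator_def)
        qed
        show "compact {x. e \<le> indicator K x * cmod (g x - \<phi> x)}" if "g \<in> A" "0 < e" for g e
          by (rule compact_superlevel_indicator[OF K(1) _ that(2)]) (intro continuous_intros A_cont that \<phi>c)
        show "compact {x. e \<le> indicator K x * cmod (\<phi> x)}" if "0 < e" for e
          by (rule compact_superlevel_indicator[OF K(1) \<phi>c that])
      qed (use \<phi> K(2) A_subspace mult_mem in \<open>auto simp: indicator_def split: if_splits\<close>)
      then obtain \<psi> where \<psi>: "\<psi> \<in> A" "\<And>x. indicator K x * cmod (\<psi> x - \<phi> x) \<le> e / 2" by blast
      have "cmod (\<psi> x - \<phi> x) < e" if "x \<in> K" for x using \<psi>(2)[of x] that K(2) by simp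
      then have "\<psi> \<in> U" using K(3) \<psi>(1) A_cont by (auto simp: complex_continuous_maps_def)
      then show "\<exists>y. y \<in> A \<and> y \<in> U" using \<psi>(1) by blast
    qed
  qed
  ultimately show ?thesis by blast
qed

end
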